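(* For every compact metric space $(S,d)$, the set of invariant distributions for $\pi_{1,2}$ is the same as the set of invariant distributions for $\pi_{2,2}$; that is, $\{\theta\in\mathcal P(S):\pi_{1,2}(\theta)=\theta\}=\{\theta\in\mathcal P(S):\pi_{2,2}(\theta)=\theta\}$.
   Context: $\mathcal P(S)$ is the set of Borel probability measures on a compact metric space $(S,d)$. Given $\theta\in\mathcal P(S)$ and integers $k\ge 2$, $1\le j\le k$, consider the Markov chain on $S$ which from state $s$ draws $k$ i.i.d. samples from $\theta$ and jumps to the $j$'th nearest of them to $s$ (ordering by increasing distance from $s$, ties broken uniformly at random). This chain has a unique stationary distribution, denoted $\pi_{j,k}(\theta)$, which defines a map $\pi_{j,k}:\mathcal P(S)\to\mathcal P(S)$. A distribution $\phi$ is invariant for $\pi_{j,k}$ if $\pi_{j,k}(\phi)=\phi$. *)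

theory Defs
  imports "HOL-Probability.Probability" "HOL-Combinatorics.Permutations"
begin

text \<open>
  The state space is the whole type; compactness is assumed as \<open>compact UNIV\<close> where needed.
  The Borel probability measures are the elements of \<^term>\<open>space (prob_algebra borel)\<close>.
\<close>

abbreviation borel_probs :: "'a::metric_space measure set" where
  "borel_probs \<equiv> space (prob_algebra borel)"

definition distance_orderings :: "nat \<Rightarrow> 'a::metric_space \<Rightarrow> (nat \<Rightarrow> 'a) \<Rightarrow> (nat \<Rightarrow> nat) set" where
  "distance_orderings k s x =
     {\<sigma>. \<sigma> permutes {1..k} \<and> mono_on {1..k} (\<lambda>i. dist s (x (\<sigma> i)))}"

text \<open>
  Ties are broken by choosing uniformly among all orderings \<open>\<sigma>\<close> of the sample indices that list
  the samples by increasing distance from \<open>s\<close>; the \<open>j\<close>-th nearest sample is then \<open>x (\<sigma> j)\<close>.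
\<close>

definition nearest_kernel ::
    "nat \<Rightarrow> nat \<Rightarrow> 'a::metric_space measure \<Rightarrow> 'a \<Rightarrow> 'a measure" where
  "nearest_kernel j k \<theta> s =
     Pi\<^sub>M {1..k} (\<lambda>_. \<theta>) \<bind>
       (\<lambda>x. distr (measure_pmf (pmf_of_set (distance_orderings k s x))) borel (\<lambda>\<sigma>. x (\<sigma> j)))"

definition stationary :: "('a::metric_space \<Rightarrow> 'a measure) \<Rightarrow> 'a measure \<Rightarrow> bool" where
  "stationary K \<mu> \<longleftrightarrow>
     \<mu> \<in> borel_probs \<and> (\<forall>A\<in>sets borel. emeasure \<mu> A = (\<integral>\<^sup>+s. emeasure (K s) A \<partial>\<mu>))"

definition nearest_map :: "nat \<Rightarrow> nat \<Rightarrow> 'a::metric_space measure \<Rightarrow> 'a measure" where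
  "nearest_map j k \<theta> = (THE \<mu>. stationary (nearest_kernel j k \<theta>) \<mu>)"

definition invariant_dists :: "nat \<Rightarrow> nat \<Rightarrow> 'a::metric_space measure set" where
  "invariant_dists j k = {\<phi> \<in> borel_probs. nearest_map j k \<phi> = \<phi>}"

end

theory Submission
  imports Defs
begin

text \<open>
  Write \<open>K\<^sub>j\<close> for the kernel that jumps to the \<open>j\<close>-th nearest of \<open>k\<close> samples from \<open>\<theta>\<close>. Whatever the
  tie-breaking, listing the samples by distance only rearranges them, so the sum of the \<open>K\<^sub>j\<close> over
  all ranks is \<open>k \<cdot> \<theta>\<close> at every state (\<open>sum_nearest_kernel\<close>). For \<open>k = 2\<close> integrating this identity
  against \<open>\<theta>\<close> gives \<open>\<theta>K\<^sub>1 + \<theta>K\<^sub>2 = 2\<theta>\<close>, hence \<open>\<theta>K\<^sub>1 = \<theta>\<close> if and only if \<open>\<theta>K\<^sub>2 = \<theta>\<close>.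

  What remains is to know that \<^term>\<open>nearest_map j k \<theta> = \<theta>\<close> really says that \<open>\<theta>\<close> is stationary for
  \<open>K\<^sub>j\<close>. Since \<^const>\<open>nearest_map\<close> is a definite description, this needs both existence and
  uniqueness of the stationary distribution, and these come from Dobrushin's contraction argument.
  All \<open>k\<close> samples fall into \<open>A\<close> with probability \<open>\<theta>(A)\<^sup>k\<close>, so \<open>K\<^sub>j(s, A) \<ge> \<theta>(A)\<^sup>k\<close> at every state
  \<open>s\<close>. As \<open>A\<close> or its complement has \<open>\<theta>\<close>-measure at least \<open>1/2\<close>, the values \<open>K\<^sub>j(s, A)\<close> and
  \<open>K\<^sub>j(s', A)\<close> differ by at most \<open>1 - 2\<^sup>-\<^sup>k\<close> (\<open>nearest_kernel_osc\<close>). A kernel whose oscillation is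
  uniformly below 1 contracts the total variation distance, and the probability measures are
  complete for that distance, so there is exactly one fixed point
  (\<open>dobrushin_unique_stationary\<close>).

  Compactness enters through measurability: the kernel is a measurable function of the state because
  the distance is measurable for the product sigma-algebra, and that holds because the space is
  separable.
\<close>

section \<open>Total variation and Dobrushin's contraction\<close>

text \<open>
  The total variation distance of \<open>\<mu>\<close> and \<open>\<nu>\<close> is at most \<open>r\<close>. Stating the bound directly
  avoids suprema over events.
\<close>

definition tv_close :: "'a measure \<Rightarrow> real \<Rightarrow> 'a measure \<Rightarrow> 'a measure \<Rightarrow> bool" where
  "tv_close M r \<mu> \<nu> \<longleftrightarrow> (\<forall>A\<in>sets M. \<bar>measure \<mu> A - measure \<nu> A\<bar> \<le> r)"

lemma tv_close_sym: "tv_close M r \<mu> \<nu> \<Longrightarrow> tv_close M r \<nu> \<mu>"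
  by (auto simp: tv_close_def abs_minus_commute)

lemma nn_integral_layer_cake:
  assumes \<mu>: "\<mu> \<in> space (prob_algebra M)"
    and g[measurable]: "g \<in> borel_measurable M"
    and g0: "\<And>x. x \<in> space M \<Longrightarrow> 0 \<le> g x" and gc: "\<And>x. x \<in> space M \<Longrightarrow> g x \<le> c"
  shows "(\<integral>\<^sup>+x. ennreal (g x) \<partial>\<mu>)
    = (\<integral>\<^sup>+t. emeasure \<mu> {x\<in>space M. t < g x} * indicator {0..<c} t \<partial>lborel)"
proof -
  interpret prob_space \<mu> using \<mu> by (simp add: space_prob_algebra)
  have sets_mu[measurable_cong]: "sets \<mu> = sets M" and sp: "space \<mu> = space M"
    using \<mu> sets_eq_imp_space_eq[of \<mu> M] by (auto simp: space_prob_algebra)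
  interpret pair_sigma_finite \<mu> lborel ..
  have "(\<integral>\<^sup>+x. ennreal (g x) \<partial>\<mu>)
      = (\<integral>\<^sup>+x. \<integral>\<^sup>+t. indicator {t. 0 \<le> t \<and> t < c \<and> t < g x} t \<partial>lborel \<partial>\<mu>)"
  proof (rule nn_integral_cong)
    fix x assume "x \<in> space \<mu>"
    then have *: "{t. 0 \<le> t \<and> t < c \<and> t < g x} = {0..<g x}" and "0 \<le> g x"
      using g0[of x] gc[of x] by (auto simp: sp)
    then show "ennreal (g x) = (\<integral>\<^sup>+t. indicator {t. 0 \<le> t \<and> t < c \<and> t < g x} t \<partial>lborel)"
      by simp
  qed
  also have "\<dots> = (\<integral>\<^sup>+t. \<integral>\<^sup>+x. indicator {t. 0 \<le> t \<and> t < c \<and> t < g x} t \<partial>\<mu> \<partial>lborel)"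
    by (rule Fubini'[symmetric]) (simp add: indicator_def, measurable)
  also have "\<dots> = (\<integral>\<^sup>+t. emeasure \<mu> {x\<in>space M. t < g x} * indicator {0..<c} t \<partial>lborel)"
  proof (rule nn_integral_cong)
    fix t :: real
    have "(\<integral>\<^sup>+x. indicator {t. 0 \<le> t \<and> t < c \<and> t < g x} t \<partial>\<mu>)
      = (\<integral>\<^sup>+x. indicator {x\<in>space M. t < g x} x * indicator {0..<c} t \<partial>\<mu>)"
      by (rule nn_integral_cong) (auto simp: sp indicator_def)
    also have "\<dots> = emeasure \<mu> {x\<in>space M. t < g x} * indicator {0..<c} t"
      by (subst nn_integral_multc) auto
    finally show "(\<integral>\<^sup>+x. indicator {t. 0 \<le> t \<and> t < c \<and> t < g x} t \<partial>\<mu>)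
      = emeasure \<mu> {x\<in>space M. t < g x} * indicator {0..<c} t" .
  qed
  finally show ?thesis .
qed

text \<open>
  By the layer-cake formula the integral of \<open>g\<close> averages the measures of its superlevel sets over
  an interval of length \<open>c\<close>, and replacing \<open>\<mu>\<close> by \<open>\<nu>\<close> changes each of these measures by at most \<open>r\<close>.
\<close>

lemma integral_le_of_tv_close:
  assumes \<mu>: "\<mu> \<in> space (prob_algebra M)" and \<nu>: "\<nu> \<in> space (prob_algebra M)"
    and close: "tv_close M r \<mu> \<nu>"
    and g[measurable]: "g \<in> borel_measurable M" and c: "0 \<le> c"
    and g0: "\<And>x. x \<in> space M \<Longrightarrow> 0 \<le> g x" and gc: "\<And>x. x \<in> space M \<Longrightarrow> g x \<le> c"
  shows "(\<integral>x. g x \<partial>\<mu>) \<le> (\<integral>x. g x \<partial>\<nu>) + c * r"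
proof -
  interpret \<mu>: prob_space \<mu> using \<mu> by (simp add: space_prob_algebra)
  interpret \<nu>: prob_space \<nu> using \<nu> by (simp add: space_prob_algebra)
  have s[measurable_cong]: "sets \<mu> = sets M" "sets \<nu> = sets M"
    and sp: "space \<mu> = space M" "space \<nu> = space M"
    using \<mu> \<nu> sets_eq_imp_space_eq[of \<mu> M] sets_eq_imp_space_eq[of \<nu> M]
    by (auto simp: space_prob_algebra)
  have r: "0 \<le> r" using close by (auto simp: tv_close_def dest!: bspec[of _ _ "{}"])
  have em: "emeasure \<mu> A \<le> emeasure \<nu> A + ennreal r" if "A \<in> sets M" for A
  proof -
    have "measure \<mu> A \<le> measure \<nu> A + r"
      using close that by (auto simp: tv_close_def dest!: bspec[of _ _ A])
    then show ?thesis
      using r by (simp add: \<mu>.emeasure_eq_measure \<nu>.emeasure_eq_measure flip: ennreal_plus)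
  qed
  have int: "integrable \<mu> g" "integrable \<nu> g"
    using g0 gc by (auto intro!: \<mu>.integrable_const_bound[where B=c] \<nu>.integrable_const_bound[where B=c] AE_I2
        simp: sp)
  have [measurable]: "(\<lambda>t. emeasure \<nu> {x\<in>space M. t < g x}) \<in> borel_measurable borel"
  proof -
    have "(\<lambda>t. \<integral>\<^sup>+x. (if t < g x then 1 else 0) \<partial>\<nu>) \<in> borel_measurable borel"
      by measurable
    also have "(\<lambda>t. \<integral>\<^sup>+x. (if t < g x then 1 else 0) \<partial>\<nu>) = (\<lambda>t. emeasure \<nu> {x\<in>space M. t < g x})"
    proof
      fix t
      have "(\<integral>\<^sup>+x. (if t < g x then 1 else 0) \<partial>\<nu>) = (\<integral>\<^sup>+x. indicator {x\<in>space M. t < g x} x \<partial>\<nu>)"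
        by (rule nn_integral_cong) (auto simp: sp indicator_def)
      then show "(\<integral>\<^sup>+x. (if t < g x then 1 else 0) \<partial>\<nu>) = emeasure \<nu> {x\<in>space M. t < g x}"
        by simp
    qed
    finally show ?thesis .
  qed
  have "ennreal (\<integral>x. g x \<partial>\<mu>) = (\<integral>\<^sup>+x. ennreal (g x) \<partial>\<mu>)"
    using int g0 by (subst nn_integral_eq_integral) (auto intro!: AE_I2 simp: sp)
  also have "\<dots> = (\<integral>\<^sup>+t. emeasure \<mu> {x\<in>space M. t < g x} * indicator {0..<c} t \<partial>lborel)"
    by (rule nn_integral_layer_cake[OF \<mu> g g0 gc])
  also have "\<dots> \<le> (\<integral>\<^sup>+t. emeasure \<nu> {x\<in>space M. t < g x} * indicator {0..<c} t
      + ennreal r * indicator {0..<c} t \<partial>lborel)"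
    by (intro nn_integral_mono) (auto simp: indicator_def intro!: em)
  also have "\<dots> = (\<integral>\<^sup>+t. emeasure \<nu> {x\<in>space M. t < g x} * indicator {0..<c} t \<partial>lborel)
      + ennreal r * ennreal c"
    using c by (subst nn_integral_add) (auto simp: nn_integral_cmult_indicator)
  also have "\<dots> = (\<integral>\<^sup>+x. ennreal (g x) \<partial>\<nu>) + ennreal r * ennreal c"
    by (subst nn_integral_layer_cake[OF \<nu> g g0 gc]) auto
  also have "\<dots> = ennreal (\<integral>x. g x \<partial>\<nu>) + ennreal r * ennreal c"
    using int g0 by (subst nn_integral_eq_integral) (auto intro!: AE_I2 simp: sp)
  also have "\<dots> = ennreal ((\<integral>x. g x \<partial>\<nu>) + c * r)"
    using r c g0 by (subst ennreal_plus) (auto simp: ennreal_mult sp mult.commute intro!: integral_nonneg_AE AE_I2)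
  finally show ?thesis
    using r c g0 by (subst (asm) ennreal_le_iff)
      (auto simp: sp intro!: add_nonneg_nonneg integral_nonneg_AE AE_I2)
qed

lemma measure_bind_kernel:
  assumes \<mu>: "\<mu> \<in> space (prob_algebra M)" and K: "K \<in> M \<rightarrow>\<^sub>M prob_algebra N" and A: "A \<in> sets N"
  shows "measure (\<mu> \<bind> K) A = (\<integral>s. measure (K s) A \<partial>\<mu>)"
proof -
  have s: "sets \<mu> = sets M" and "prob_space \<mu>" using \<mu> by (auto simp: space_prob_algebra)
  then interpret prob_space \<mu> by simp
  have "K \<in> \<mu> \<rightarrow>\<^sub>M subprob_algebra N"
    using measurable_prob_algebraD[OF K] s by (simp cong: measurable_cong_sets)
  then show ?thesis by (intro measure_bind[OF _ A])
qed

lemma bind_in_prob_algebra: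
  assumes \<mu>: "\<mu> \<in> space (prob_algebra M)" and K: "K \<in> M \<rightarrow>\<^sub>M prob_algebra N"
  shows "\<mu> \<bind> K \<in> space (prob_algebra N)"
  using prob_space_bind'[OF assms] sets_bind'[OF assms] by (simp add: space_prob_algebra)

text \<open>
  The function \<open>s \<mapsto> K(s, A)\<close> takes values in an interval of length \<open>c\<close>. Subtracting its infimum does
  not change the difference of its integrals against two probability measures, and leaves a
  function with values between \<open>0\<close> and \<open>c\<close>, to which the preceding bound applies.
\<close>

lemma tv_close_bind:
  assumes K: "K \<in> M \<rightarrow>\<^sub>M prob_algebra N"
    and osc: "\<And>A s s'. A \<in> sets N \<Longrightarrow> s \<in> space M \<Longrightarrow> s' \<in> space M \<Longrightarrow>
      measure (K s) A - measure (K s') A \<le> c"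
    and \<mu>: "\<mu> \<in> space (prob_algebra M)" and \<nu>: "\<nu> \<in> space (prob_algebra M)"
    and close: "tv_close M r \<mu> \<nu>"
  shows "tv_close N (c * r) (\<mu> \<bind> K) (\<nu> \<bind> K)"
proof -
  have one_sided: "measure (\<mu> \<bind> K) A \<le> measure (\<nu> \<bind> K) A + c * r"
    if A: "A \<in> sets N" and \<mu>: "\<mu> \<in> space (prob_algebra M)" and \<nu>: "\<nu> \<in> space (prob_algebra M)"
      and close: "tv_close M r \<mu> \<nu>" for A \<mu> \<nu>
  proof -
    interpret \<mu>: prob_space \<mu> using \<mu> by (simp add: space_prob_algebra)
    interpret \<nu>: prob_space \<nu> using \<nu> by (simp add: space_prob_algebra)
    have s[measurable_cong]: "sets \<mu> = sets M" "sets \<nu> = sets M"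
      and sp: "space \<mu> = space M" "space \<nu> = space M"
      using \<mu> \<nu> sets_eq_imp_space_eq[of \<mu> M] sets_eq_imp_space_eq[of \<nu> M]
      by (auto simp: space_prob_algebra)
    define f where "f s = measure (K s) A" for s
    have f[measurable]: "f \<in> borel_measurable M"
      using measurable_compose[OF K measurable_measure_prob_algebra[OF A]] by (simp add: f_def[abs_def])
    have prob: "prob_space (K s)" if "s \<in> space M" for s
      using measurable_space[OF K that] by (simp add: space_prob_algebra)
    define a where "a = (INF s\<in>space M. f s)"
    have ne: "space M \<noteq> {}" using \<mu>.not_empty sp by simp
    have bdd: "bdd_below (f ` space M)" by (auto simp: f_def intro!: bdd_belowI[of _ 0])
    have a_le: "a \<le> f s" if "s \<in> space M" for s
      unfolding a_def by (rule cINF_lower[OF bdd that])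
    have le_a: "f s - c \<le> a" if "s \<in> space M" for s
      unfolding a_def using osc[OF A that] by (intro cINF_greatest[OF ne]) (simp add: f_def algebra_simps)
    obtain s0 where "s0 \<in> space M" using ne by auto
    then have c: "0 \<le> c" using osc[OF A, of s0 s0] by simp
    have int: "integrable \<mu> f" "integrable \<nu> f"
      using prob by (auto intro!: \<mu>.integrable_const_bound[where B=1]
          \<nu>.integrable_const_bound[where B=1] AE_I2 simp: sp f_def prob_space.prob_le_1)
    have "(\<integral>x. f x - a \<partial>\<mu>) \<le> (\<integral>x. f x - a \<partial>\<nu>) + c * r"
      using a_le le_a by (intro integral_le_of_tv_close[OF \<mu> \<nu> close _ c]) (auto simp: algebra_simps)
    then have "(\<integral>x. f x \<partial>\<mu>) \<le> (\<integral>x. f x \<partial>\<nu>) + c * r"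
      using int by (simp add: \<mu>.prob_space \<nu>.prob_space)
    then show ?thesis
      by (simp add: measure_bind_kernel[OF _ K A] \<mu> \<nu> f_def)
  qed
  show ?thesis
    unfolding tv_close_def
    using one_sided[OF _ \<mu> \<nu> close] one_sided[OF _ \<nu> \<mu> tv_close_sym[OF close]]
    by (auto simp: abs_le_iff algebra_simps)
qed

text \<open>
  The setwise limit of a sequence that is Cauchy in total variation is attained uniformly over all
  events. The uniformity is what makes it countably additive: along a sequence of events decreasing
  to the empty set, the limit is within \<open>e n\<close> of the measure \<open>\<mu> n\<close>, which is continuous there.
\<close>

lemma tv_complete:
  fixes e :: "nat \<Rightarrow> real"
  assumes \<mu>: "\<And>n. \<mu> n \<in> space (prob_algebra M)"
    and e: "e \<longlonglongrightarrow> 0"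
    and close: "\<And>m n. m \<le> n \<Longrightarrow> tv_close M (e m) (\<mu> m) (\<mu> n)"
  shows "\<exists>L\<in>space (prob_algebra M). \<forall>n. tv_close M (e n) (\<mu> n) L"
proof -
  have P: "prob_space (\<mu> n)" and S: "sets (\<mu> n) = sets M" and SP: "space (\<mu> n) = space M" for n
    using \<mu>[of n] sets_eq_imp_space_eq[of "\<mu> n" M] by (auto simp: space_prob_algebra)
  interpret P: prob_space "\<mu> n" for n by (rule P)
  define l where "l A = lim (\<lambda>n. measure (\<mu> n) A)" for A
  have e_bound: "\<bar>measure (\<mu> m) A - measure (\<mu> n) A\<bar> \<le> e m" if "A \<in> sets M" "m \<le> n" for A m n
    using close[OF that(2)] that(1) by (auto simp: tv_close_def)
  have tends: "(\<lambda>n. measure (\<mu> n) A) \<longlonglongrightarrow> l A" if A: "A \<in> sets M" for A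
  proof -
    have "Cauchy (\<lambda>n. measure (\<mu> n) A)"
    proof (rule metric_CauchyI)
      fix \<epsilon> :: real assume "0 < \<epsilon>"
      then have "eventually (\<lambda>n. e n < \<epsilon> / 2) sequentially"
        by (intro order_tendstoD(2)[OF e]) auto
      then obtain N where N: "e N < \<epsilon> / 2" by (auto simp: eventually_sequentially)
      show "\<exists>N. \<forall>m\<ge>N. \<forall>n\<ge>N. dist (measure (\<mu> m) A) (measure (\<mu> n) A) < \<epsilon>"
      proof (intro exI[of _ N] allI impI)
        fix m n assume "N \<le> m" "N \<le> n"
        then show "dist (measure (\<mu> m) A) (measure (\<mu> n) A) < \<epsilon>"
          using e_bound[OF A, of N m] e_bound[OF A, of N n] N by (auto simp: dist_real_def)
      qed
    qed
    then show ?thesis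
      unfolding l_def by (simp add: Cauchy_convergent convergent_LIMSEQ_iff[symmetric])
  qed
  have l_close: "\<bar>measure (\<mu> n) A - l A\<bar> \<le> e n" if A: "A \<in> sets M" for A n
  proof (rule LIMSEQ_le_const2)
    show "(\<lambda>m. \<bar>measure (\<mu> n) A - measure (\<mu> m) A\<bar>) \<longlonglongrightarrow> \<bar>measure (\<mu> n) A - l A\<bar>"
      by (intro tendsto_intros tends A)
    show "\<exists>N. \<forall>m\<ge>N. \<bar>measure (\<mu> n) A - measure (\<mu> m) A\<bar> \<le> e n"
      using e_bound[OF A] by blast
  qed
  have l_nonneg: "0 \<le> l A" if "A \<in> sets M" for A
    by (rule LIMSEQ_le_const[OF tends[OF that]]) auto
  have l_empty: "l {} = 0"
    using LIMSEQ_unique[OF tends[of "{}"], of 0] by simp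
  have l_space: "l (space M) = 1"
    using LIMSEQ_unique[OF tends[of "space M"], of 1] P.prob_space by (simp add: SP)
  have l_add: "l (A \<union> B) = l A + l B" if "A \<in> sets M" "B \<in> sets M" "A \<inter> B = {}" for A B
  proof -
    have "(\<lambda>n. measure (\<mu> n) (A \<union> B)) \<longlonglongrightarrow> l A + l B"
      using that by (simp add: P.finite_measure_Union S tendsto_add tends)
    then show ?thesis using LIMSEQ_unique tends[of "A \<union> B"] that by blast
  qed
  have l_cont: "(\<lambda>i. l (A i)) \<longlonglongrightarrow> 0"
    if A: "range A \<subseteq> sets M" "decseq A" "(\<Inter>i. A i) = {}" for A
  proof (rule LIMSEQ_I)
    fix \<epsilon> :: real assume "0 < \<epsilon>"
    then have "eventually (\<lambda>n. e n < \<epsilon> / 2) sequentially"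
      by (intro order_tendstoD(2)[OF e]) auto
    then obtain n where n: "e n < \<epsilon> / 2" by (auto simp: eventually_sequentially)
    have "(\<lambda>i. measure (\<mu> n) (A i)) \<longlonglongrightarrow> measure (\<mu> n) (\<Inter>i. A i)"
      using A by (intro P.finite_Lim_measure_decseq) (auto simp: S)
    then have "eventually (\<lambda>i. measure (\<mu> n) (A i) < \<epsilon> / 2) sequentially"
      using A \<open>0 < \<epsilon>\<close> by (intro order_tendstoD(2)[where y=0]) auto
    then obtain N where N: "\<And>i. N \<le> i \<Longrightarrow> measure (\<mu> n) (A i) < \<epsilon> / 2"
      by (auto simp: eventually_sequentially)
    show "\<exists>N. \<forall>i\<ge>N. norm (l (A i) - 0) < \<epsilon>"
    proof (intro exI[of _ N] allI impI)
      fix i assume "N \<le> i"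
      moreover have "A i \<in> sets M" using A by auto
      ultimately show "norm (l (A i) - 0) < \<epsilon>"
        using N[of i] n l_close[of "A i" n] l_nonneg[of "A i"] by auto
    qed
  qed
  have "positive (sets M) (\<lambda>A. ennreal (l A))"
    by (simp add: positive_def l_empty)
  moreover have "countably_additive (sets M) (\<lambda>A. ennreal (l A))"
  proof (rule sets.empty_continuous_imp_countably_additive)
    show "additive (sets M) (\<lambda>A. ennreal (l A))"
      by (auto simp: additive_def l_add l_nonneg)
    show "(\<lambda>i. ennreal (l (A i))) \<longlonglongrightarrow> 0"
      if "range A \<subseteq> sets M" "decseq A" "(\<Inter>i. A i) = {}" for A
      using tendsto_ennrealI[OF l_cont[OF that]] by simp
  qed (use calculation in auto)
  ultimately have em: "emeasure (measure_of (space M) (sets M) (\<lambda>A. ennreal (l A))) A = ennreal (l A)"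
    if "A \<in> sets M" for A
    using that by (intro emeasure_measure_of_sigma) (auto simp: sets.sigma_algebra_axioms)
  define L where "L = measure_of (space M) (sets M) (\<lambda>A. ennreal (l A))"
  have L: "L \<in> space (prob_algebra M)"
    unfolding space_prob_algebra
    by (auto simp: L_def em l_space intro!: prob_spaceI)
  moreover have "tv_close M (e n) (\<mu> n) L" for n
    using l_close[of _ n] em l_nonneg by (auto simp: tv_close_def L_def measure_def)
  ultimately show ?thesis by blast
qed

text \<open>
  This is Banach's fixed point argument for \<open>\<mu> \<mapsto> \<mu>K\<close>. Any two probability measures are at distance
  at most 1, so after \<open>n\<close> steps their images are within \<open>c\<^sup>n\<close>.
\<close>

lemma dobrushin_unique_stationary:
  assumes K: "K \<in> M \<rightarrow>\<^sub>M prob_algebra M" and ne: "space M \<noteq> {}" and c: "c < 1"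
    and osc: "\<And>A s s'. A \<in> sets M \<Longrightarrow> s \<in> space M \<Longrightarrow> s' \<in> space M \<Longrightarrow>
      measure (K s) A - measure (K s') A \<le> c"
  shows "\<exists>!\<mu>. \<mu> \<in> space (prob_algebra M) \<and> \<mu> \<bind> K = \<mu>"
proof -
  obtain s0 where s0: "s0 \<in> space M" using ne by auto
  have c0: "0 \<le> c" using osc[OF sets.top s0 s0] by simp
  note contract = tv_close_bind[OF K osc]
  have tv_close_1: "tv_close M 1 \<mu> \<nu>"
    if "\<mu> \<in> space (prob_algebra M)" "\<nu> \<in> space (prob_algebra M)" for \<mu> \<nu>
  proof -
    interpret \<mu>: prob_space \<mu> using that by (simp add: space_prob_algebra)
    interpret \<nu>: prob_space \<nu> using that by (simp add: space_prob_algebra)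
    have "\<bar>measure \<mu> A - measure \<nu> A\<bar> \<le> 1" for A
      using \<mu>.prob_le_1[of A] \<nu>.prob_le_1[of A] measure_nonneg[of \<mu> A] measure_nonneg[of \<nu> A]
      by linarith
    then show ?thesis by (simp add: tv_close_def)
  qed
  have pow: "(\<lambda>n. c ^ n) \<longlonglongrightarrow> 0" using c c0 by (intro LIMSEQ_realpow_zero)
  have tv_eq: "\<mu> = \<nu>" if \<mu>\<nu>: "\<mu> \<in> space (prob_algebra M)" "\<nu> \<in> space (prob_algebra M)"
    and close: "\<And>n. tv_close M (c ^ n) \<mu> \<nu>" for \<mu> \<nu>
  proof (rule measure_eqI)
    show "sets \<mu> = sets \<nu>" using \<mu>\<nu> by (simp add: space_prob_algebra)
    fix A assume "A \<in> sets \<mu>"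
    then have "A \<in> sets M" using \<mu>\<nu> by (simp add: space_prob_algebra)
    then have "\<bar>measure \<mu> A - measure \<nu> A\<bar> \<le> 0"
      using close by (intro LIMSEQ_le_const[OF pow]) (auto simp: tv_close_def)
    moreover have "prob_space \<mu>" "prob_space \<nu>" using \<mu>\<nu> by (auto simp: space_prob_algebra)
    ultimately show "emeasure \<mu> A = emeasure \<nu> A"
      by (simp add: finite_measure.emeasure_eq_measure prob_space.finite_measure)
  qed
  define \<mu> where "\<mu> n = ((\<lambda>\<nu>. \<nu> \<bind> K) ^^ n) (return M s0)" for n
  have \<mu>_Suc: "\<mu> (Suc n) = \<mu> n \<bind> K" for n by (simp add: \<mu>_def)
  have \<mu>: "\<mu> n \<in> space (prob_algebra M)" for n
  proof (induction n)
    case 0 show ?case using s0 by (simp add: \<mu>_def space_prob_algebra prob_space_return)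
  next
    case (Suc n) then show ?case unfolding \<mu>_Suc by (rule bind_in_prob_algebra[OF _ K])
  qed
  have close: "tv_close M (c ^ n) (\<mu> n) (\<mu> (n + p))" for n p
  proof (induction n)
    case 0 show ?case using tv_close_1[OF \<mu> \<mu>] by simp
  next
    case (Suc n) then show ?case using contract[OF _ _ _ \<mu> \<mu>] by (simp add: \<mu>_Suc)
  qed
  have "tv_close M (c ^ m) (\<mu> m) (\<mu> n)" if "m \<le> n" for m n
    using close[of m "n - m"] that by simp
  from tv_complete[OF \<mu> pow this]
  obtain L where L: "L \<in> space (prob_algebra M)" and L_close: "\<And>n. tv_close M (c ^ n) (\<mu> n) L"
    by blast
  have LK: "L \<bind> K \<in> space (prob_algebra M)" by (rule bind_in_prob_algebra[OF L K])
  have fix_L: "L \<bind> K = L"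
  proof (rule measure_eqI)
    show "sets (L \<bind> K) = sets L" using L LK by (simp add: space_prob_algebra)
    fix A assume "A \<in> sets (L \<bind> K)"
    then have A: "A \<in> sets M" using LK by (simp add: space_prob_algebra)
    have "(\<lambda>n. 2 * c ^ Suc n) \<longlonglongrightarrow> 2 * 0" by (intro tendsto_intros LIMSEQ_Suc[OF pow])
    moreover have "\<bar>measure (L \<bind> K) A - measure L A\<bar> \<le> 2 * c ^ Suc n" for n
    proof -
      have "tv_close M (c * c ^ n) (\<mu> n \<bind> K) (L \<bind> K)"
        by (rule contract[OF _ _ _ \<mu> L L_close])
      then have "\<bar>measure (\<mu> (Suc n)) A - measure (L \<bind> K) A\<bar> \<le> c ^ Suc n"
        using A by (simp add: tv_close_def \<mu>_Suc)
      moreover have "\<bar>measure (\<mu> (Suc n)) A - measure L A\<bar> \<le> c ^ Suc n"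
        using A L_close[of "Suc n"] unfolding tv_close_def by blast
      ultimately show ?thesis by linarith
    qed
    ultimately have "\<bar>measure (L \<bind> K) A - measure L A\<bar> \<le> 2 * 0"
      using LIMSEQ_le_const by blast
    moreover have "prob_space L" "prob_space (L \<bind> K)" using L LK by (auto simp: space_prob_algebra)
    ultimately show "emeasure (L \<bind> K) A = emeasure L A"
      by (simp add: finite_measure.emeasure_eq_measure prob_space.finite_measure)
  qed
  show ?thesis
  proof (intro ex1I[of _ L] conjI L fix_L)
    fix \<nu> assume \<nu>: "\<nu> \<in> space (prob_algebra M) \<and> \<nu> \<bind> K = \<nu>"
    have "tv_close M (c ^ n) \<nu> L" for n
    proof (induction n)
      case 0 show ?case using tv_close_1 \<nu> L by simp
    next
      case (Suc n)
      have "tv_close M (c * c ^ n) (\<nu> \<bind> K) (L \<bind> K)"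
        using \<nu> L Suc by (intro contract) auto
      then show ?case using \<nu> fix_L by simp
    qed
    then show "\<nu> = L" using tv_eq \<nu> L by blast
  qed
qed

section \<open>The nearest-sample kernel is a Markov kernel\<close>

text \<open>
  Without this, \<^const>\<open>pmf_of_set\<close> would not be the uniform distribution on the orderings. The
  witness is a list of the indices sorted by distance; the shift by one reconciles list positions,
  which start at 0, with ranks, which start at 1.
\<close>

lemma distance_orderings_nonempty: "distance_orderings k s x \<noteq> {}"
proof -
  define xs where "xs = sort_key (\<lambda>i. dist s (x i)) [1..<Suc k]"
  have len: "length xs = k" and dist: "distinct xs" and set: "set xs = {1..k}"
    by (auto simp: xs_def)
  have sorted: "sorted (map (\<lambda>i. dist s (x i)) xs)" by (simp add: xs_def)
  define \<sigma> where "\<sigma> i = (if i \<in> {1..k} then xs ! (i - 1) else i)" for i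
  have "inj_on \<sigma> {1..k}"
    using dist by (auto simp: inj_on_def \<sigma>_def nth_eq_iff_index_eq len)
  moreover have "\<sigma> ` {1..k} \<subseteq> {1..k}"
  proof
    fix y assume "y \<in> \<sigma> ` {1..k}"
    then have "y \<in> set xs" by (auto simp: \<sigma>_def len)
    then show "y \<in> {1..k}" by (simp add: set)
  qed
  ultimately have "bij_betw \<sigma> {1..k} {1..k}"
    by (simp add: bij_betw_def endo_inj_surj)
  then have "\<sigma> permutes {1..k}"
    by (rule bij_imp_permutes) (simp only: \<sigma>_def if_False)
  moreover have "mono_on {1..k} (\<lambda>i. dist s (x (\<sigma> i)))"
  proof (rule mono_onI)
    fix i j assume "i \<in> {1..k}" "j \<in> {1..k}" "i \<le> j"
    then show "dist s (x (\<sigma> i)) \<le> dist s (x (\<sigma> j))"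
      using sorted_nth_mono[OF sorted, of "i - 1" "j - 1"] by (auto simp: \<sigma>_def len)
  qed
  ultimately show ?thesis by (auto simp: distance_orderings_def)
qed

lemma finite_distance_orderings: "finite (distance_orderings k s x)"
  by (rule finite_subset[OF _ finite_permutations[of "{1..k}"]]) (auto simp: distance_orderings_def)

text \<open>
  The distance is continuous, but continuity alone gives measurability only for the Borel
  sigma-algebra of the product space, which may be larger than the product sigma-algebra. A compact
  metric space has a countable dense set \<open>Q\<close>, and \<open>d(s, x)\<close> is the infimum of \<open>d(s, q) + d(q, x)\<close>
  over \<open>q \<in> Q\<close>: a countable infimum of functions that separate the two coordinates.
\<close>

lemma compact_UNIV_borel_measurable_dist:
  assumes "compact (UNIV :: 'a::metric_space set)"
  shows "(\<lambda>p. dist (fst p) (snd p)) \<in> borel_measurable ((borel :: 'a measure) \<Otimes>\<^sub>M borel)"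
proof -
  have "\<exists>k. finite k \<and> (UNIV :: 'a set) \<subseteq> (\<Union>x\<in>k. ball x (1 / Suc n))" for n
    using seq_compact_imp_totally_bounded[OF compact_imp_seq_compact[OF assms]]
    by (metis divide_pos_pos of_nat_0_less_iff zero_less_Suc zero_less_one)
  then obtain D :: "nat \<Rightarrow> 'a set"
    where D: "\<And>n. finite (D n)" "\<And>n. UNIV \<subseteq> (\<Union>x\<in>D n. ball x (1 / Suc n))" by metis
  \<comment> \<open>the centres of all the finite nets together are dense\<close>
  define Q where "Q = (\<Union>n. D n)"
  have Q: "countable Q" unfolding Q_def using D(1) by (auto intro: countable_finite)
  have bdd: "bdd_below ((\<lambda>q. dist s q + dist q x) ` Q)" for s x
    by (auto intro!: bdd_belowI[of _ 0])
  have ne: "Q \<noteq> {}" using D(2)[of 0] unfolding Q_def by blast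
  have "dist s x = (INF q\<in>Q. dist s q + dist q x)" for s x
  proof (rule antisym)
    show "dist s x \<le> (INF q\<in>Q. dist s q + dist q x)"
      by (intro cINF_greatest ne dist_triangle)
    show "(INF q\<in>Q. dist s q + dist q x) \<le> dist s x"
    proof (rule field_le_epsilon)
      fix e :: real assume "0 < e"
      then obtain n where n: "1 / Suc n < e / 2"
        using nat_approx_posE[of "e / 2"] by auto
      obtain q where q: "q \<in> D n" "dist q x < 1 / Suc n"
        using D(2)[of n] by (auto simp: subset_eq)
      have "(INF q\<in>Q. dist s q + dist q x) \<le> dist s q + dist q x"
        using q by (intro cINF_lower bdd) (auto simp: Q_def)
      also have "\<dots> \<le> dist s x + 2 * dist q x"
        using dist_triangle[of s q x] by (simp add: dist_commute)
      finally show "(INF q\<in>Q. dist s q + dist q x) \<le> dist s x + e" using q n by linarith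
    qed
  qed
  then have *: "(\<lambda>p. dist (fst p) (snd p)) = (\<lambda>p :: 'a \<times> 'a. INF q\<in>Q. dist (fst p) q + dist q (snd p))"
    by (rule ext)
  have [measurable]: "(\<lambda>x. dist x q) \<in> borel_measurable borel" "(\<lambda>x. dist q x) \<in> borel_measurable borel"
    for q :: 'a
    by (auto intro!: borel_measurable_continuous_onI continuous_intros)
  show ?thesis
    unfolding * using Q by measurable
qed

text \<open>
  The set of admissible orderings takes finitely many values, each on a measurable set described by
  comparisons of distances. On each of these pieces the law of the picked sample comes from a fixed
  distribution on the index of that sample, and evaluating the sample vector at a given index is
  measurable.
\<close>

lemma measurable_nearest_pick:
  assumes comp: "compact (UNIV :: 'a::metric_space set)"
  shows "(\<lambda>(s, x). distr (measure_pmf (pmf_of_set (distance_orderings k s x))) borel (\<lambda>\<sigma>. x (\<sigma> j)))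
    \<in> (borel :: 'a measure) \<Otimes>\<^sub>M PiM {1..k} (\<lambda>_. borel) \<rightarrow>\<^sub>M prob_algebra borel"
proof -
  let ?M = "(borel :: 'a measure) \<Otimes>\<^sub>M PiM {1..k} (\<lambda>_. borel :: 'a measure)"
  let ?P = "{\<sigma>. \<sigma> permutes {1..k}}"
  define ord where "ord p = distance_orderings k (fst p) (snd p)" for p :: "'a \<times> (nat \<Rightarrow> 'a)"
  have finP: "finite ?P" by (rule finite_permutations) simp
  have O_sub: "ord p \<subseteq> ?P" for p by (auto simp: ord_def distance_orderings_def)
  have dist_meas: "(\<lambda>p. dist (fst p) (snd p i)) \<in> borel_measurable ?M" if "i \<in> {1..k}" for i
  proof -
    have "(\<lambda>p. (fst p, snd p i)) \<in> ?M \<rightarrow>\<^sub>M borel \<Otimes>\<^sub>M borel"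
      using that by measurable
    from measurable_compose[OF this compact_UNIV_borel_measurable_dist[OF comp]]
    show ?thesis by simp
  qed
  have mem: "Measurable.pred ?M (\<lambda>p. \<sigma> \<in> ord p)" if \<sigma>: "\<sigma> \<in> ?P" for \<sigma>
  proof -
    have eq: "(\<lambda>p. \<sigma> \<in> ord p) = (\<lambda>p. \<forall>a\<in>{1..k}. \<forall>b\<in>{1..k}. a \<le> b \<longrightarrow>
        dist (fst p) (snd p (\<sigma> a)) \<le> dist (fst p) (snd p (\<sigma> b)))"
      using \<sigma> by (auto simp: ord_def distance_orderings_def monotone_on_def)
    have "Measurable.pred ?M (\<lambda>p. dist (fst p) (snd p (\<sigma> a)) \<le> dist (fst p) (snd p (\<sigma> b)))"
      if "a \<in> {1..k}" "b \<in> {1..k}" for a b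
    proof -
      have "\<sigma> a \<in> {1..k}" "\<sigma> b \<in> {1..k}" using \<sigma> that permutes_in_image[of \<sigma> "{1..k}"] by blast+
      note dist_meas[OF this(1), measurable] dist_meas[OF this(2), measurable]
      show ?thesis by measurable
    qed
    then show ?thesis
      unfolding eq by (intro pred_intros_finite pred_intros_logic) auto
  qed
  have O_meas: "ord \<in> ?M \<rightarrow>\<^sub>M count_space (Pow ?P)"
  proof (subst measurable_count_space_eq2, use finP in simp, intro conjI ballI)
    show "ord \<in> space ?M \<rightarrow> Pow ?P" using O_sub by auto
    fix B assume B: "B \<in> Pow ?P"
    have "Measurable.pred ?M (\<lambda>p. \<forall>\<sigma>\<in>?P. \<sigma> \<in> ord p \<longleftrightarrow> \<sigma> \<in> B)"
      using mem by (intro pred_intros_finite(3) finP pred_intros_logic) auto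
    moreover have "ord -` {B} \<inter> space ?M = {p\<in>space ?M. \<forall>\<sigma>\<in>?P. \<sigma> \<in> ord p \<longleftrightarrow> \<sigma> \<in> B}"
      using B O_sub by blast
    ultimately show "ord -` {B} \<inter> space ?M \<in> sets ?M"
      by (simp add: pred_def)
  qed
  \<comment> \<open>Passing from the ordering to the index it selects replaces permutations, elements of an
      uncountable type, by natural numbers, so that evaluation is measurable piece by piece.\<close>
  have pick: "(\<lambda>p. distr (measure_pmf (map_pmf (\<lambda>\<sigma>. \<sigma> j) (pmf_of_set B))) borel (snd p))
    \<in> ?M \<rightarrow>\<^sub>M prob_algebra borel" for B
  proof (rule measurable_distr_prob_space2)
    show "(\<lambda>p. measure_pmf (map_pmf (\<lambda>\<sigma>. \<sigma> j) (pmf_of_set B))) \<in> ?M \<rightarrow>\<^sub>M prob_algebra (count_space UNIV)"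
      by (rule measurable_const) (simp add: space_prob_algebra measure_pmf.prob_space_axioms)
    have "(\<lambda>p. snd (fst p) (snd p)) \<in> ?M \<Otimes>\<^sub>M count_space UNIV \<rightarrow>\<^sub>M borel"
    proof (rule measurable_compose_countable[where f="\<lambda>i p. snd (fst p) i"])
      fix i
      show "(\<lambda>p. snd (fst p) i) \<in> ?M \<Otimes>\<^sub>M count_space UNIV \<rightarrow>\<^sub>M (borel :: 'a measure)"
      proof (cases "i \<in> {1..k}")
        case True then show ?thesis by measurable
      next
        \<comment> \<open>points of the product space are undefined outside the index set\<close>
        case False
        then have "snd (fst p) i = undefined" if "p \<in> space (?M \<Otimes>\<^sub>M count_space UNIV)" for p
          using that by (auto simp: space_pair_measure space_PiM PiE_def extensional_def)
        then show ?thesis by (subst measurable_cong[where g="\<lambda>_. undefined"]) auto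
      qed
    qed measurable
    then show "(\<lambda>(p, i). snd p i) \<in> ?M \<Otimes>\<^sub>M count_space UNIV \<rightarrow>\<^sub>M (borel :: 'a measure)"
      by (simp add: case_prod_unfold)
  qed
  have "(\<lambda>p. distr (measure_pmf (map_pmf (\<lambda>\<sigma>. \<sigma> j) (pmf_of_set (ord p)))) borel (snd p))
    \<in> ?M \<rightarrow>\<^sub>M prob_algebra borel"
    by (rule measurable_compose_countable'[where
          f="\<lambda>B p. distr (measure_pmf (map_pmf (\<lambda>\<sigma>. \<sigma> j) (pmf_of_set B))) borel (snd p)", OF pick O_meas])
       (use finP in \<open>auto intro: countable_finite\<close>)
  moreover have "distr (measure_pmf (map_pmf (\<lambda>\<sigma>. \<sigma> j) (pmf_of_set B))) borel x
      = distr (measure_pmf (pmf_of_set B)) borel (\<lambda>\<sigma>. x (\<sigma> j))" for B and x :: "nat \<Rightarrow> 'a"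
    by (simp add: map_pmf_rep_eq distr_distr comp_def)
  ultimately show ?thesis by (simp add: case_prod_unfold ord_def)
qed

lemma PiM_in_prob_algebra:
  assumes "\<theta> \<in> borel_probs"
  shows "PiM I (\<lambda>_. \<theta>) \<in> space (prob_algebra (PiM I (\<lambda>_. borel)))"
  using assms by (auto simp: space_prob_algebra intro!: prob_space_PiM sets_PiM_cong)

lemma measurable_nearest_kernel:
  assumes comp: "compact (UNIV :: 'a::metric_space set)" and \<theta>: "\<theta> \<in> (borel_probs :: 'a measure set)"
  shows "nearest_kernel j k \<theta> \<in> borel \<rightarrow>\<^sub>M prob_algebra borel"
  unfolding nearest_kernel_def[abs_def]
  by (rule measurable_bind_prob_space2[OF measurable_const[OF PiM_in_prob_algebra[OF \<theta>]]
        measurable_nearest_pick[OF comp]])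

lemma emeasure_nearest_kernel:
  assumes comp: "compact (UNIV :: 'a::metric_space set)" and \<theta>: "\<theta> \<in> (borel_probs :: 'a measure set)"
    and A: "A \<in> sets borel"
  shows "emeasure (nearest_kernel j k \<theta> s) A
    = (\<integral>\<^sup>+x. emeasure (measure_pmf (pmf_of_set (distance_orderings k s x))) {\<sigma>. x (\<sigma> j) \<in> A} \<partial>PiM {1..k} (\<lambda>_. \<theta>))"
proof -
  have "(\<lambda>x. distr (measure_pmf (pmf_of_set (distance_orderings k s x))) borel (\<lambda>\<sigma>. x (\<sigma> j)))
      \<in> PiM {1..k} (\<lambda>_. borel) \<rightarrow>\<^sub>M prob_algebra borel"
    using measurable_compose[OF measurable_Pair1' measurable_nearest_pick[OF comp], of s] by simp
  from emeasure_bind_prob_algebra[OF PiM_in_prob_algebra[OF \<theta>] this A]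
  show ?thesis using A by (simp add: nearest_kernel_def emeasure_distr vimage_def)
qed

section \<open>Lower bound and rank sum of the kernel\<close>

text \<open>If all samples lie in \<open>A\<close>, so does the \<open>j\<close>-th nearest, from whatever state one looks.\<close>

lemma nearest_kernel_ge_power:
  assumes comp: "compact (UNIV :: 'a::metric_space set)" and \<theta>: "\<theta> \<in> (borel_probs :: 'a measure set)"
    and A: "A \<in> sets borel" and j: "j \<in> {1..k}"
  shows "measure \<theta> A ^ k \<le> measure (nearest_kernel j k \<theta> s) A"
proof -
  interpret \<theta>: prob_space \<theta> using \<theta> by (simp add: space_prob_algebra)
  interpret K: prob_space "nearest_kernel j k \<theta> s"
    using measurable_space[OF measurable_nearest_kernel[OF comp \<theta>], of s] by (simp add: space_prob_algebra)
  interpret product_sigma_finite "\<lambda>_::nat. \<theta>" by standard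
  have A': "A \<in> sets \<theta>" using A \<theta> by (simp add: space_prob_algebra)
  have "ennreal (measure \<theta> A ^ k) = emeasure (PiM {1..k} (\<lambda>_. \<theta>)) (PiE {1..k} (\<lambda>_. A))"
    using A' by (subst emeasure_PiM) (auto simp: \<theta>.emeasure_eq_measure ennreal_power)
  also have "\<dots> = (\<integral>\<^sup>+x. indicator (PiE {1..k} (\<lambda>_. A)) x \<partial>PiM {1..k} (\<lambda>_. \<theta>))"
    using A' by (subst nn_integral_indicator) (auto intro: sets_PiM_I_finite)
  also have "\<dots> \<le> (\<integral>\<^sup>+x. emeasure (measure_pmf (pmf_of_set (distance_orderings k s x))) {\<sigma>. x (\<sigma> j) \<in> A}
      \<partial>PiM {1..k} (\<lambda>_. \<theta>))"
  proof (intro nn_integral_mono)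
    fix x
    have "emeasure (measure_pmf (pmf_of_set (distance_orderings k s x))) {\<sigma>. x (\<sigma> j) \<in> A} = 1"
      if "x \<in> PiE {1..k} (\<lambda>_. A)"
    proof (rule measure_pmf.emeasure_eq_1_AE)
      have "x (\<sigma> j) \<in> A" if "\<sigma> \<in> distance_orderings k s x" for \<sigma>
        using that j \<open>x \<in> _\<close> permutes_in_image[of \<sigma> "{1..k}" j]
        unfolding distance_orderings_def PiE_iff by blast
      then show "AE \<sigma> in measure_pmf (pmf_of_set (distance_orderings k s x)). \<sigma> \<in> {\<sigma>. x (\<sigma> j) \<in> A}"
        by (simp add: AE_measure_pmf_iff set_pmf_of_set distance_orderings_nonempty finite_distance_orderings)
    qed simp
    then show "indicator (PiE {1..k} (\<lambda>_. A)) x \<le>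
        emeasure (measure_pmf (pmf_of_set (distance_orderings k s x))) {\<sigma>. x (\<sigma> j) \<in> A}"
      by (auto simp: indicator_def)
  qed
  also have "\<dots> = ennreal (measure (nearest_kernel j k \<theta> s) A)"
    using emeasure_nearest_kernel[OF comp \<theta> A, of j k s] by (simp only: K.emeasure_eq_measure)
  finally show ?thesis by simp
qed

text \<open>
  An ordering is a permutation of the samples, so the number of ranks whose sample lies in \<open>A\<close> is the
  number of samples in \<open>A\<close>. Its expectation is \<open>k \<cdot> \<theta>(A)\<close>, because each sample has law \<open>\<theta>\<close>.
\<close>

lemma sum_nearest_kernel:
  assumes comp: "compact (UNIV :: 'a::metric_space set)" and \<theta>: "\<theta> \<in> (borel_probs :: 'a measure set)"
    and A: "A \<in> sets borel"
  shows "(\<Sum>j=1..k. emeasure (nearest_kernel j k \<theta> s) A) = of_nat k * emeasure \<theta> A"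
proof -
  have A': "A \<in> sets \<theta>" and P: "prob_space \<theta>" using A \<theta> by (auto simp: space_prob_algebra)
  interpret product_prob_space "\<lambda>_::nat. \<theta>" "{1..k}"
    using P by (simp add: product_prob_space_def product_prob_space_axioms_def product_sigma_finite_def
        prob_space_imp_sigma_finite)
  let ?p = "\<lambda>x. measure_pmf (pmf_of_set (distance_orderings k s x))"
  have meas: "(\<lambda>x. emeasure (?p x) {\<sigma>. x (\<sigma> j) \<in> A}) \<in> borel_measurable (PiM {1..k} (\<lambda>_. \<theta>))" for j
  proof -
    have "(\<lambda>x. distr (?p x) borel (\<lambda>\<sigma>. x (\<sigma> j))) \<in> PiM {1..k} (\<lambda>_. borel) \<rightarrow>\<^sub>M prob_algebra borel"
      using measurable_compose[OF measurable_Pair1' measurable_nearest_pick[OF comp], of s] by simp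
    from measurable_compose[OF measurable_prob_algebraD[OF this] measurable_emeasure_subprob_algebra[OF A]]
    have "(\<lambda>x. emeasure (?p x) {\<sigma>. x (\<sigma> j) \<in> A}) \<in> borel_measurable (PiM {1..k} (\<lambda>_. borel))"
      using A by (simp add: emeasure_distr vimage_def)
    moreover have "sets (PiM {1..k} (\<lambda>_. \<theta>)) = sets (PiM {1..k} (\<lambda>_. borel))"
      using \<theta> by (intro sets_PiM_cong) (auto simp: space_prob_algebra)
    ultimately show ?thesis by (simp cong: measurable_cong_sets)
  qed
  have rearrange: "(\<Sum>j=1..k. emeasure (?p x) {\<sigma>. x (\<sigma> j) \<in> A}) = (\<Sum>i=1..k. indicator A (x i))" for x
  proof -
    have "(\<Sum>j=1..k. emeasure (?p x) {\<sigma>. x (\<sigma> j) \<in> A})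
        = (\<Sum>j=1..k. \<integral>\<^sup>+\<sigma>. indicator A (x (\<sigma> j)) \<partial>?p x)"
    proof (rule sum.cong[OF refl])
      fix j
      have "(\<integral>\<^sup>+\<sigma>. indicator A (x (\<sigma> j)) \<partial>?p x) = (\<integral>\<^sup>+\<sigma>. indicator {\<sigma>. x (\<sigma> j) \<in> A} \<sigma> \<partial>?p x)"
        by (rule nn_integral_cong) (simp add: indicator_def)
      then show "emeasure (?p x) {\<sigma>. x (\<sigma> j) \<in> A} = (\<integral>\<^sup>+\<sigma>. indicator A (x (\<sigma> j)) \<partial>?p x)"
        by simp
    qed
    also have "\<dots> = (\<integral>\<^sup>+\<sigma>. (\<Sum>j=1..k. indicator A (x (\<sigma> j))) \<partial>?p x)"
      by (simp add: nn_integral_sum)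
    also have "\<dots> = (\<integral>\<^sup>+\<sigma>. (\<Sum>i=1..k. indicator A (x i)) \<partial>?p x)"
    proof (rule nn_integral_cong_AE)
      have "(\<Sum>j=1..k. indicator A (x (\<sigma> j))) = (\<Sum>i=1..k. indicator A (x i) :: ennreal)"
        if "\<sigma> \<in> distance_orderings k s x" for \<sigma>
        using that by (intro sum.reindex_bij_betw) (auto simp: distance_orderings_def permutes_imp_bij)
      then show "AE \<sigma> in ?p x. (\<Sum>j=1..k. indicator A (x (\<sigma> j))) = (\<Sum>i=1..k. indicator A (x i) :: ennreal)"
        by (simp add: AE_measure_pmf_iff set_pmf_of_set distance_orderings_nonempty finite_distance_orderings)
    qed
    finally show ?thesis by simp
  qed
  have "(\<Sum>j=1..k. emeasure (nearest_kernel j k \<theta> s) A)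
      = (\<integral>\<^sup>+x. (\<Sum>j=1..k. emeasure (?p x) {\<sigma>. x (\<sigma> j) \<in> A}) \<partial>PiM {1..k} (\<lambda>_. \<theta>))"
    unfolding emeasure_nearest_kernel[OF comp \<theta> A] by (rule nn_integral_sum[symmetric]) (rule meas)
  also have "\<dots> = (\<Sum>i=1..k. \<integral>\<^sup>+x. indicator A (x i) \<partial>PiM {1..k} (\<lambda>_. \<theta>))"
    unfolding rearrange using A' by (subst nn_integral_sum) auto
  also have "\<dots> = (\<Sum>i=1..k. emeasure \<theta> A)"
  proof (rule sum.cong[OF refl])
    fix i assume i: "i \<in> {1..k}"
    have "(\<integral>\<^sup>+x. indicator A (x i) \<partial>PiM {1..k} (\<lambda>_. \<theta>))
        = (\<integral>\<^sup>+y. indicator A y \<partial>distr (PiM {1..k} (\<lambda>_. \<theta>)) \<theta> (\<lambda>x. x i))"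
      using A' i by (subst nn_integral_distr) auto
    then show "(\<integral>\<^sup>+x. indicator A (x i) \<partial>PiM {1..k} (\<lambda>_. \<theta>)) = emeasure \<theta> A"
      unfolding PiM_component[OF i] using A' by simp
  qed
  finally show ?thesis by simp
qed

section \<open>Invariance as stationarity\<close>

lemma stationary_iff_bind:
  assumes "K \<in> borel \<rightarrow>\<^sub>M prob_algebra borel"
  shows "stationary K \<mu> \<longleftrightarrow> \<mu> \<in> borel_probs \<and> \<mu> \<bind> K = \<mu>"
proof (cases "\<mu> \<in> borel_probs")
  case True
  have "\<mu> \<bind> K = \<mu> \<longleftrightarrow> (\<forall>A\<in>sets borel. emeasure (\<mu> \<bind> K) A = emeasure \<mu> A)"
    using True sets_bind'[OF True assms] by (auto simp: space_prob_algebra intro!: measure_eqI)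
  then show ?thesis
    using True emeasure_bind_prob_algebra[OF True assms] by (auto simp: stationary_def)
qed (simp add: stationary_def)

text \<open>
  One of \<open>A\<close> and its complement has \<open>\<theta>\<close>-measure at least \<open>1/2\<close>. In the first case \<open>K(s', A)\<close> is at
  least \<open>2\<^sup>-\<^sup>k\<close>; in the second \<open>K(s, A)\<close> is at most \<open>1 - 2\<^sup>-\<^sup>k\<close>.
\<close>

lemma nearest_kernel_osc:
  assumes comp: "compact (UNIV :: 'a::metric_space set)" and \<theta>: "\<theta> \<in> (borel_probs :: 'a measure set)"
    and A: "A \<in> sets borel" and j: "j \<in> {1..k}"
  shows "measure (nearest_kernel j k \<theta> s) A - measure (nearest_kernel j k \<theta> s') A \<le> 1 - (1 / 2) ^ k"
proof -
  have K: "prob_space (nearest_kernel j k \<theta> s)" "space (nearest_kernel j k \<theta> s) = UNIV"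
    "sets (nearest_kernel j k \<theta> s) = sets borel" for s
    using measurable_space[OF measurable_nearest_kernel[OF comp \<theta>], of s j k]
      sets_eq_imp_space_eq[of "nearest_kernel j k \<theta> s" borel]
    by (auto simp: space_prob_algebra)
  interpret \<theta>: prob_space \<theta> using \<theta> by (simp add: space_prob_algebra)
  have sets_\<theta>: "sets \<theta> = sets borel" and space_\<theta>: "space \<theta> = UNIV"
    using \<theta> sets_eq_imp_space_eq[of \<theta> borel] by (auto simp: space_prob_algebra)
  show ?thesis
  proof (cases "1 / 2 \<le> measure \<theta> A")
    case True
    then have "(1 / 2) ^ k \<le> measure \<theta> A ^ k" by (intro power_mono) auto
    then show ?thesis
      using nearest_kernel_ge_power[OF comp \<theta> A j, of s'] prob_space.prob_le_1[OF K(1), of s A]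
      by linarith
  next
    case False
    then have "1 / 2 \<le> measure \<theta> (- A)"
      using \<theta>.prob_compl[of A] A by (simp add: sets_\<theta> space_\<theta> Compl_eq_Diff_UNIV)
    then have "(1 / 2) ^ k \<le> measure \<theta> (- A) ^ k" by (intro power_mono) auto
    moreover have "measure (nearest_kernel j k \<theta> s) (- A) = 1 - measure (nearest_kernel j k \<theta> s) A"
      using prob_space.prob_compl[OF K(1), of A s] A by (simp add: K Compl_eq_Diff_UNIV)
    ultimately show ?thesis
      using nearest_kernel_ge_power[OF comp \<theta> borel_comp[OF A] j, of s]
        measure_nonneg[of "nearest_kernel j k \<theta> s'" A]
      by linarith
  qed
qed

lemma nearest_kernel_ex1_stationary:
  assumes comp: "compact (UNIV :: 'a::metric_space set)" and \<theta>: "\<theta> \<in> (borel_probs :: 'a measure set)"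
    and j: "j \<in> {1..k}"
  shows "\<exists>!\<mu>. stationary (nearest_kernel j k \<theta>) \<mu>"
proof -
  note K = measurable_nearest_kernel[OF comp \<theta>]
  show ?thesis
    unfolding stationary_iff_bind[OF K]
    by (rule dobrushin_unique_stationary[OF K _ _ nearest_kernel_osc[OF comp \<theta> _ j]]) auto
qed

lemma invariant_dists_iff_stationary:
  assumes comp: "compact (UNIV :: 'a::metric_space set)" and j: "j \<in> {1..k}"
  shows "\<theta> \<in> (invariant_dists j k :: 'a measure set) \<longleftrightarrow>
    \<theta> \<in> borel_probs \<and> stationary (nearest_kernel j k \<theta>) \<theta>"
proof (cases "\<theta> \<in> borel_probs")
  case True
  note ex1 = nearest_kernel_ex1_stationary[OF comp True j]
  have "nearest_map j k \<theta> = \<theta> \<longleftrightarrow> stationary (nearest_kernel j k \<theta>) \<theta>"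
    using theI'[OF ex1] the1_equality[OF ex1] unfolding nearest_map_def by metis
  with True show ?thesis by (simp add: invariant_dists_def)
qed (simp add: invariant_dists_def)

theorem theorem3:
  assumes "compact (UNIV :: 'a::metric_space set)"
  shows "(invariant_dists 1 2 :: 'a measure set) = invariant_dists 2 2"
proof -
  have "stationary (nearest_kernel 1 2 \<theta>) \<theta> \<longleftrightarrow> stationary (nearest_kernel 2 2 \<theta>) \<theta>"
    if \<theta>: "\<theta> \<in> borel_probs" for \<theta> :: "'a measure"
  proof -
    interpret \<theta>: prob_space \<theta> using \<theta> by (simp add: space_prob_algebra)
    have sets_\<theta>[measurable_cong]: "sets \<theta> = sets borel" using \<theta> by (simp add: space_prob_algebra)
    \<comment> \<open>the two integrals add up to \<open>2\<theta>(A)\<close>, which is finite, so each equals \<open>\<theta>(A)\<close> if the other does\<close>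
    have balance: "emeasure \<theta> A = (\<integral>\<^sup>+s. emeasure (nearest_kernel 1 2 \<theta> s) A \<partial>\<theta>) \<longleftrightarrow>
        emeasure \<theta> A = (\<integral>\<^sup>+s. emeasure (nearest_kernel 2 2 \<theta> s) A \<partial>\<theta>)"
      if A: "A \<in> sets borel" for A
    proof -
      let ?I = "\<lambda>j. \<integral>\<^sup>+s. emeasure (nearest_kernel j 2 \<theta> s) A \<partial>\<theta>"
      have meas[measurable]: "(\<lambda>s. emeasure (nearest_kernel j 2 \<theta> s) A) \<in> borel_measurable borel" for j
        using measurable_compose[OF measurable_prob_algebraD[OF measurable_nearest_kernel[OF assms \<theta>]]
            measurable_emeasure_subprob_algebra[OF A]] .
      have sum2: "emeasure (nearest_kernel 1 2 \<theta> s) A + emeasure (nearest_kernel 2 2 \<theta> s) A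
          = emeasure \<theta> A + emeasure \<theta> A" for s
        using sum_nearest_kernel[OF assms \<theta> A, of 2 s] by (simp add: numeral_2_eq_2 mult_2 distrib_right)
      have "?I 1 + ?I 2 = (\<integral>\<^sup>+s. emeasure (nearest_kernel 1 2 \<theta> s) A + emeasure (nearest_kernel 2 2 \<theta> s) A \<partial>\<theta>)"
        by (rule nn_integral_add[symmetric]) measurable
      also have "\<dots> = emeasure \<theta> A + emeasure \<theta> A"
        unfolding sum2 by (simp add: \<theta>.emeasure_space_1)
      finally have "?I 1 + ?I 2 = emeasure \<theta> A + emeasure \<theta> A" .
      then show ?thesis
        using \<theta>.emeasure_finite[of A] by (metis add.commute ennreal_add_left_cancel infinity_ennreal_def)
    qed
    then show ?thesis by (simp add: stationary_def)
  qed
  then show ?thesis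
    using invariant_dists_iff_stationary[OF assms, of 1 2] invariant_dists_iff_stationary[OF assms, of 2 2]
    by auto
qed

end
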